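(* Let $\Gamma=\langle\alpha_1,\ldots,\alpha_k\rangle\subset\mathbb N^d$ be an affine semigroup and $\gamma\in\Gamma$. For each $i\le k$ with $\gamma-\alpha_i\in\Gamma$, let $T_i\subseteq K_\gamma$ be the image, under the cover morphism $\psi_i:K_{\gamma-\alpha_i}\to K_\gamma$, of a minimum weight spanning tree of $K_{\gamma-\alpha_i}$; for $i$ with $\gamma-\alpha_i\notin\Gamma$ let $E(T_i)=\emptyset$. Let $E'$ be the set of elements $(z,w)$ of the Graver basis of $\Gamma$ with $z,w\in\mathsf Z(\gamma)$, viewed as edges of $K_\gamma$. Then the graph $G'=(\mathsf Z(\gamma),E(T_1)\cup\cdots\cup E(T_k)\cup E')$ is connected, and every minimum weight spanning tree of $G'$ is a minimum weight spanning tree of $K_\gamma$.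
   Context: An affine semigroup is a finitely generated submonoid of $\mathbb N^d$ with minimal generating set $\alpha_1,\ldots,\alpha_k$; $\varphi_\Gamma(z)=z_1\alpha_1+\cdots+z_k\alpha_k$ for $z\in\mathbb N^k$, $\mathsf Z(\gamma)=\varphi_\Gamma^{-1}(\gamma)$, and $|z|=z_1+\cdots+z_k$. For $z,w\in\mathbb N^k$, $\gcd(z,w)=(\min(z_1,w_1),\ldots,\min(z_k,w_k))$ and $\mathrm{dist}(z,w)=\max(|z-\gcd(z,w)|,|w-\gcd(z,w)|)$. The catenary graph $K_\gamma$ is the complete graph on $\mathsf Z(\gamma)$ with each edge $\{z,w\}$ labeled $\mathrm{dist}(z,w)$; subgraphs inherit these labels. The cover morphism $\psi_i:K_{\gamma-\alpha_i}\to K_\gamma$ sends each vertex $z\in\mathsf Z(\gamma-\alpha_i)$ to $z+e_i$ ($e_i$ the $i$-th unit vector) and each edge $\{z,w\}$ to $\{z+e_i,w+e_i\}$. In an edge-labeled graph, the weight of a chain $v_0,\ldots,v_r$ (consecutive vertices adjacent) is its largest edge label; a spanning tree $T$ is of minimum weight if, for any two vertices, the unique path between them in $T$ has minimum weight among all chains in the graph joining them. The Graver basis of $\Gamma$ is the minimal generating set (Hilbert basis) of the affine semigroup $\{(z,w)\in\mathbb N^k\times\mathbb N^k:\varphi_\Gamma(z)=\varphi_\Gamma(w)\}$. *)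

theory Defs
  imports Complex_Main "HOL-Library.Function_Algebras" "HOL-Library.Product_Plus"
begin

(* N^n is the set of functions nat => nat vanishing outside {..<n}; in this way n = 0 is allowed. *)
definition nvec :: "nat \<Rightarrow> (nat \<Rightarrow> nat) set" where
  "nvec n = {v. \<forall>i\<ge>n. v i = 0}"

definition add_submonoid :: "'a::comm_monoid_add set \<Rightarrow> bool" where
  "add_submonoid M \<longleftrightarrow> 0 \<in> M \<and> (\<forall>x\<in>M. \<forall>y\<in>M. x + y \<in> M)"

definition minimal_generating_set :: "'a::comm_monoid_add set \<Rightarrow> 'a set \<Rightarrow> bool" where
  "minimal_generating_set B M \<longleftrightarrow>
     add_submonoid hull B = M \<and> (\<forall>A. A \<subset> B \<longrightarrow> add_submonoid hull A \<noteq> M)"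

definition affine_semigroup :: "nat \<Rightarrow> (nat \<Rightarrow> nat) set \<Rightarrow> bool" where
  "affine_semigroup d M \<longleftrightarrow>
     add_submonoid M \<and> M \<subseteq> nvec d \<and> (\<exists>A. finite A \<and> add_submonoid hull A = M)"

definition fact_hom :: "nat \<Rightarrow> (nat \<Rightarrow> nat \<Rightarrow> nat) \<Rightarrow> (nat \<Rightarrow> nat) \<Rightarrow> (nat \<Rightarrow> nat)" where
  "fact_hom k \<alpha> z = (\<lambda>j. \<Sum>i<k. z i * \<alpha> i j)"

definition factorizations :: "nat \<Rightarrow> (nat \<Rightarrow> nat \<Rightarrow> nat) \<Rightarrow> (nat \<Rightarrow> nat) \<Rightarrow> (nat \<Rightarrow> nat) set" where
  "factorizations k \<alpha> \<gamma> = {z \<in> nvec k. fact_hom k \<alpha> z = \<gamma>}"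

definition vlen :: "nat \<Rightarrow> (nat \<Rightarrow> nat) \<Rightarrow> nat" where
  "vlen k z = (\<Sum>i<k. z i)"

definition vgcd :: "(nat \<Rightarrow> nat) \<Rightarrow> (nat \<Rightarrow> nat) \<Rightarrow> (nat \<Rightarrow> nat)" where
  "vgcd z w = (\<lambda>i. min (z i) (w i))"

definition vdist :: "nat \<Rightarrow> (nat \<Rightarrow> nat) \<Rightarrow> (nat \<Rightarrow> nat) \<Rightarrow> nat" where
  "vdist k z w = max (vlen k (z - vgcd z w)) (vlen k (w - vgcd z w))"

definition unit_vec :: "nat \<Rightarrow> (nat \<Rightarrow> nat)" where
  "unit_vec i = (\<lambda>j. if j = i then 1 else 0)"

definition graver_basis :: "nat \<Rightarrow> (nat \<Rightarrow> nat \<Rightarrow> nat) \<Rightarrow> ((nat \<Rightarrow> nat) \<times> (nat \<Rightarrow> nat)) set" where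
  "graver_basis k \<alpha> = (THE B. minimal_generating_set B
     {(z, w). z \<in> nvec k \<and> w \<in> nvec k \<and> fact_hom k \<alpha> z = fact_hom k \<alpha> w})"

(* Simple undirected graphs; an edge is a two-element set of vertices. An edge labeling is given
   separately, as a symmetric function of the two endpoints, so that subgraphs inherit it. *)
record 'v ugraph =
  verts :: "'v set"
  edges :: "'v set set"

definition is_chain :: "'v ugraph \<Rightarrow> 'v \<Rightarrow> 'v list \<Rightarrow> 'v \<Rightarrow> bool" where
  "is_chain G u p v \<longleftrightarrow> p \<noteq> [] \<and> hd p = u \<and> last p = v \<and> set p \<subseteq> verts G \<and>
     successively (\<lambda>x y. {x, y} \<in> edges G) p"

definition is_path :: "'v ugraph \<Rightarrow> 'v \<Rightarrow> 'v list \<Rightarrow> 'v \<Rightarrow> bool" where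
  "is_path G u p v \<longleftrightarrow> is_chain G u p v \<and> distinct p"

definition connected_graph :: "'v ugraph \<Rightarrow> bool" where
  "connected_graph G \<longleftrightarrow> verts G \<noteq> {} \<and> (\<forall>u\<in>verts G. \<forall>v\<in>verts G. \<exists>p. is_chain G u p v)"

definition is_cycle :: "'v ugraph \<Rightarrow> 'v list \<Rightarrow> bool" where
  "is_cycle G p \<longleftrightarrow> 3 \<le> length p \<and> is_path G (hd p) p (last p) \<and> {last p, hd p} \<in> edges G"

definition spanning_tree :: "'v ugraph \<Rightarrow> 'v ugraph \<Rightarrow> bool" where
  "spanning_tree G T \<longleftrightarrow> verts T = verts G \<and> edges T \<subseteq> edges G \<and>
     connected_graph T \<and> (\<nexists>p. is_cycle T p)"

(* A one-vertex chain has no edges; its weight is 0. *)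
definition chain_weight :: "('v \<Rightarrow> 'v \<Rightarrow> nat) \<Rightarrow> 'v list \<Rightarrow> nat" where
  "chain_weight l p = Max (insert 0 {l (p ! i) (p ! Suc i) | i. Suc i < length p})"

definition min_weight_spanning_tree ::
    "('v \<Rightarrow> 'v \<Rightarrow> nat) \<Rightarrow> 'v ugraph \<Rightarrow> 'v ugraph \<Rightarrow> bool" where
  "min_weight_spanning_tree l G T \<longleftrightarrow> spanning_tree G T \<and>
     (\<forall>u\<in>verts G. \<forall>v\<in>verts G. \<forall>p c. is_path T u p v \<longrightarrow> is_chain G u c v \<longrightarrow>
        chain_weight l p \<le> chain_weight l c)"

definition graph_image :: "('v \<Rightarrow> 'w) \<Rightarrow> 'v ugraph \<Rightarrow> 'w ugraph" where
  "graph_image f G = \<lparr>verts = f ` verts G, edges = (\<lambda>e. f ` e) ` edges G\<rparr>"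

definition catenary_graph ::
    "nat \<Rightarrow> (nat \<Rightarrow> nat \<Rightarrow> nat) \<Rightarrow> (nat \<Rightarrow> nat) \<Rightarrow> (nat \<Rightarrow> nat) ugraph" where
  "catenary_graph k \<alpha> \<gamma> = \<lparr>verts = factorizations k \<alpha> \<gamma>,
     edges = {{z, w} | z w. z \<in> factorizations k \<alpha> \<gamma> \<and> w \<in> factorizations k \<alpha> \<gamma> \<and> z \<noteq> w}\<rparr>"

definition cover_morphism :: "nat \<Rightarrow> (nat \<Rightarrow> nat) \<Rightarrow> (nat \<Rightarrow> nat)" where
  "cover_morphism i z = z + unit_vec i"

(* gamma - delta in M, the difference being taken in Z^d: subtraction on nat truncates. *)
definition diff_in :: "(nat \<Rightarrow> nat) \<Rightarrow> (nat \<Rightarrow> nat) \<Rightarrow> (nat \<Rightarrow> nat) set \<Rightarrow> bool" where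
  "diff_in \<gamma> \<delta> M \<longleftrightarrow> \<delta> \<le> \<gamma> \<and> \<gamma> - \<delta> \<in> M"

(* The Graver basis also contains the pairs (e_i, e_i); these are not edges of the catenary graph,
   whence the condition z \<noteq> w. *)
definition graver_edges ::
    "nat \<Rightarrow> (nat \<Rightarrow> nat \<Rightarrow> nat) \<Rightarrow> (nat \<Rightarrow> nat) \<Rightarrow> (nat \<Rightarrow> nat) set set" where
  "graver_edges k \<alpha> \<gamma> = {{z, w} | z w. (z, w) \<in> graver_basis k \<alpha> \<and>
     z \<in> factorizations k \<alpha> \<gamma> \<and> w \<in> factorizations k \<alpha> \<gamma> \<and> z \<noteq> w}"

end

theory Submission imports Defs begin

text \<open>
  It suffices to join the ends of every edge \<open>{z, w}\<close> of the catenary graph by a chain of \<open>G'\<close> of weight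
  at most \<open>dist(z, w)\<close>. If \<open>z\<close> and \<open>w\<close> share the generator \<open>i\<close>, the path of \<open>T\<^sub>i\<close> does this, as
  translation preserves distances. If they are disjoint and \<open>(z, w)\<close> is not in the Graver basis, write
  \<open>(z, w) = (z\<^sub>1, w\<^sub>1) + (z\<^sub>2, w\<^sub>2)\<close> with both pairs nonzero. Generators are nonzero, so all four
  vectors are nonzero, and the steps of \<open>z, w\<^sub>1 + z\<^sub>2, w\<close> are both of the first kind and no longer
  than \<open>max(|z|, |w|) = dist(z, w)\<close>.
\<close>

section \<open>Atoms and minimal generating sets of commutative monoids\<close>

lemma add_submonoid_hull: "add_submonoid (add_submonoid hull A)"
  by (rule hull_in) (auto simp: add_submonoid_def)

text \<open>The nonzero elements with only trivial decompositions. In a monoid of vectors over the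
  naturals they form the Hilbert basis.\<close>

definition monoid_atoms :: "'a::comm_monoid_add set \<Rightarrow> 'a set" where
  "monoid_atoms M = {x \<in> M. x \<noteq> 0 \<and> (\<forall>y\<in>M. \<forall>z\<in>M. x = y + z \<longrightarrow> y = 0 \<or> z = 0)}"

text \<open>An atom is not a sum of two other elements, so \<open>M\<close> without it is still a
  submonoid. If \<open>B\<close> missed the atom, its hull would lie in this smaller
  submonoid.\<close>

lemma monoid_atoms_subset_generating:
  assumes "add_submonoid hull B = M"
  shows "monoid_atoms M \<subseteq> B"
proof
  fix a assume a: "a \<in> monoid_atoms M"
  have M: "add_submonoid M" using add_submonoid_hull[of B] assms by simp
  have sub: "B \<subseteq> M" using hull_subset[of B add_submonoid] assms by simp
  show "a \<in> B"
  proof (rule ccontr)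
    assume "a \<notin> B"
    have "add_submonoid (M - {a})"
      unfolding add_submonoid_def
    proof (intro conjI ballI)
      show "0 \<in> M - {a}" using M a by (auto simp: add_submonoid_def monoid_atoms_def)
      fix x y assume xy: "x \<in> M - {a}" "y \<in> M - {a}"
      have "x + y \<noteq> a"
      proof
        assume "x + y = a"
        then have "x = 0 \<or> y = 0" using a xy by (auto simp: monoid_atoms_def)
        then show False using \<open>x + y = a\<close> xy by auto
      qed
      then show "x + y \<in> M - {a}" using M xy by (auto simp: add_submonoid_def)
    qed
    then have "add_submonoid hull B \<subseteq> M - {a}"
      using sub \<open>a \<notin> B\<close> by (intro hull_minimal) auto
    then show False using a assms unfolding monoid_atoms_def by auto
  qed
qed

text \<open>Induction on an additive \<open>size\<close> that vanishes on \<open>M\<close> only at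
  0: a nonzero element that is no atom splits into two nonzero summands, both of strictly smaller
  size.\<close>

lemma hull_monoid_atoms:
  fixes size :: "'a::comm_monoid_add \<Rightarrow> nat"
  assumes M: "add_submonoid M"
    and add: "\<And>x y. size (x + y) = size x + size y"
    and pos: "\<And>x. x \<in> M \<Longrightarrow> size x = 0 \<Longrightarrow> x = 0"
  shows "add_submonoid hull (monoid_atoms M) = M"
proof
  show "add_submonoid hull (monoid_atoms M) \<subseteq> M"
    using M by (intro hull_minimal) (auto simp: monoid_atoms_def)
  let ?H = "add_submonoid hull (monoid_atoms M)"
  have H: "0 \<in> ?H" "\<And>x y. x \<in> ?H \<Longrightarrow> y \<in> ?H \<Longrightarrow> x + y \<in> ?H"
    using add_submonoid_hull[of "monoid_atoms M"] by (auto simp: add_submonoid_def)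
  have "x \<in> M \<Longrightarrow> x \<in> ?H" for x
  proof (induction "size x" arbitrary: x rule: less_induct)
    case less
    show ?case
    proof (cases "x = 0 \<or> x \<in> monoid_atoms M")
      case True
      then show ?thesis using H(1) hull_subset[of "monoid_atoms M" add_submonoid] by blast
    next
      case False
      then obtain y z where yz: "y \<in> M" "z \<in> M" "x = y + z" "y \<noteq> 0" "z \<noteq> 0"
        using less.prems unfolding monoid_atoms_def by blast
      then have "size y > 0" "size z > 0" using pos by blast+
      then have "y \<in> ?H" "z \<in> ?H" using less.hyps yz by (auto simp: add)
      then show ?thesis using H(2) yz by blast
    qed
  qed
  then show "M \<subseteq> ?H" by blast
qed

text \<open>Every generating set contains the atoms, and the atoms already generate. Hence the
  minimal generating set exists and is unique, which a definite description such as
  \<open>graver_basis\<close> requires.\<close>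

lemma minimal_generating_set_iff_monoid_atoms:
  fixes size :: "'a::comm_monoid_add \<Rightarrow> nat"
  assumes "add_submonoid M"
    and "\<And>x y. size (x + y) = size x + size y"
    and "\<And>x. x \<in> M \<Longrightarrow> size x = 0 \<Longrightarrow> x = 0"
  shows "minimal_generating_set B M \<longleftrightarrow> B = monoid_atoms M"
proof -
  have hull: "add_submonoid hull monoid_atoms M = M" using assms by (rule hull_monoid_atoms)
  show ?thesis
  proof
    assume B: "minimal_generating_set B M"
    then have "monoid_atoms M \<subseteq> B"
      by (intro monoid_atoms_subset_generating) (simp add: minimal_generating_set_def)
    moreover have "\<not> monoid_atoms M \<subset> B"
      using B hull by (auto simp: minimal_generating_set_def)
    ultimately show "B = monoid_atoms M" by blast
  next
    assume B: "B = monoid_atoms M"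
    have "add_submonoid hull A \<noteq> M" if "A \<subset> B" for A
      using monoid_atoms_subset_generating[of A M] that B by auto
    then show "minimal_generating_set B M" using hull B by (simp add: minimal_generating_set_def)
  qed
qed

text \<open>Every submonoid contains 0, so removing 0 from \<open>B\<close> would not change the
  hull. This is the source of the fact that all \<alpha>_i are nonzero.\<close>

lemma zero_notin_minimal_generating_set:
  assumes "minimal_generating_set B M"
  shows "0 \<notin> B"
proof
  assume 0: "0 \<in> B"
  have "0 \<in> add_submonoid hull (B - {0})"
    using add_submonoid_hull add_submonoid_def by blast
  then have "B \<subseteq> add_submonoid hull (B - {0})"
    using hull_subset[of "B - {0}" add_submonoid] by blast
  then have "add_submonoid hull B \<subseteq> add_submonoid hull (B - {0})"
    using add_submonoid_hull by (rule hull_minimal)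
  moreover have "add_submonoid hull (B - {0}) \<subseteq> add_submonoid hull B"
    by (rule hull_mono) auto
  ultimately show False
    using assms 0 unfolding minimal_generating_set_def by (metis Diff_subset Diff_iff psubsetI
        singletonI subset_antisym)
qed

section \<open>Factorizations, lengths and distances\<close>

lemma fact_hom_add: "fact_hom k \<alpha> (z + w) = fact_hom k \<alpha> z + fact_hom k \<alpha> w"
  by (auto simp: fact_hom_def fun_eq_iff sum.distrib algebra_simps)

lemma fact_hom_zero [simp]: "fact_hom k \<alpha> 0 = 0"
  by (auto simp: fact_hom_def fun_eq_iff)

lemma fact_hom_unit_vec: "i < k \<Longrightarrow> fact_hom k \<alpha> (unit_vec i) = \<alpha> i"
  by (auto simp: fact_hom_def unit_vec_def fun_eq_iff if_distrib[of "\<lambda>x. x * _"] cong: if_cong)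

lemma unit_vec_nvec: "i < k \<Longrightarrow> unit_vec i \<in> nvec k"
  by (auto simp: unit_vec_def nvec_def)

lemma nvec_zero [simp]: "0 \<in> nvec k"
  by (auto simp: nvec_def)

lemma nvec_add_iff [simp]: "z + w \<in> nvec k \<longleftrightarrow> z \<in> nvec k \<and> w \<in> nvec k"
  by (auto simp: nvec_def)

lemma vlen_add: "vlen k (z + w) = vlen k z + vlen k w"
  by (simp add: vlen_def sum.distrib)

lemma vlen_eq_zero: "z \<in> nvec k \<Longrightarrow> vlen k z = 0 \<Longrightarrow> z = 0"
  unfolding vlen_def nvec_def fun_eq_iff by simp (metis lessThan_iff not_le)

text \<open>The gcd commutes with translation, so \<open>u\<close> cancels from both
  differences.\<close>

lemma vdist_add: "vdist k (u + z) (u + w) = vdist k z w"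
proof -
  have "u + z - vgcd (u + z) (u + w) = z - vgcd z w" "u + w - vgcd (u + z) (u + w) = w - vgcd z w"
    by (auto simp: vgcd_def fun_eq_iff)
  then show ?thesis by (simp add: vdist_def)
qed

lemma vdist_le: "vdist k z w \<le> max (vlen k z) (vlen k w)"
  unfolding vdist_def vlen_def by (intro max.mono sum_mono) auto

lemma vdist_disjoint: "vgcd z w = 0 \<Longrightarrow> vdist k z w = max (vlen k z) (vlen k w)"
  by (simp add: vdist_def)

text \<open>The image is a submonoid containing each generator as the image of a unit vector;
  conversely, multiples of generators and their partial sums stay in the hull. Thus membership in
  \<Gamma> means having a factorization.\<close>

lemma hull_generators_eq_fact_hom_image:
  "add_submonoid hull (\<alpha> ` {..<k}) = fact_hom k \<alpha> ` nvec k"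
proof
  have "add_submonoid (fact_hom k \<alpha> ` nvec k)"
    unfolding add_submonoid_def
    by (auto simp: fact_hom_add[symmetric] intro!: image_eqI[of _ _ "0::nat \<Rightarrow> nat"])
  moreover have "\<alpha> ` {..<k} \<subseteq> fact_hom k \<alpha> ` nvec k"
    by (metis fact_hom_unit_vec unit_vec_nvec image_eqI image_subsetI lessThan_iff)
  ultimately show "add_submonoid hull (\<alpha> ` {..<k}) \<subseteq> fact_hom k \<alpha> ` nvec k"
    by (rule hull_minimal[rotated])
next
  let ?H = "add_submonoid hull (\<alpha> ` {..<k})"
  have H: "0 \<in> ?H" "\<And>x y. x \<in> ?H \<Longrightarrow> y \<in> ?H \<Longrightarrow> x + y \<in> ?H"
    using add_submonoid_hull[of "\<alpha> ` {..<k}"] by (auto simp: add_submonoid_def)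
  have mult: "(\<lambda>j. n * \<alpha> i j) \<in> ?H" if "i < k" for n i
  proof (induction n)
    case 0
    then show ?case using H(1) by (simp add: zero_fun_def)
  next
    case (Suc n)
    have "\<alpha> i \<in> ?H" using that by (simp add: hull_inc)
    from H(2)[OF this Suc] show ?case by (simp add: plus_fun_def)
  qed
  \<comment> \<open>The sum is truncated at \<open>n\<close> to allow induction;
    \<open>n \<le> k\<close> keeps every index within the range of the generators.\<close>
  have "n \<le> k \<Longrightarrow> (\<lambda>j. \<Sum>i<n. z i * \<alpha> i j) \<in> ?H" for z n
  proof (induction n)
    case 0
    then show ?case using H(1) by (simp add: zero_fun_def)
  next
    case (Suc n)
    then show ?case using H(2)[OF _ mult[of n "z n"]] by (simp add: plus_fun_def)
  qed
  then show "fact_hom k \<alpha> ` nvec k \<subseteq> ?H" by (auto simp: fact_hom_def)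
qed

text \<open>No cancellation occurs among natural numbers: at a coordinate where \<alpha>_i is
  positive, the vanishing sum forces the i-th coefficient to be 0.\<close>

lemma fact_hom_eq_zero:
  assumes "\<And>i. i < k \<Longrightarrow> \<alpha> i \<noteq> 0" "z \<in> nvec k" "fact_hom k \<alpha> z = 0"
  shows "z = 0"
proof
  fix i
  show "z i = 0 i"
  proof (cases "i < k")
    case True
    then obtain j where j: "\<alpha> i j \<noteq> 0" using assms(1) by (auto simp: fun_eq_iff)
    have "(\<Sum>i<k. z i * \<alpha> i j) = 0" using fun_cong[OF assms(3), of j] by (simp add: fact_hom_def)
    then show ?thesis using True j by auto
  qed (use assms(2) in \<open>auto simp: nvec_def\<close>)
qed

text \<open>The total length |z| + |w| serves as the additive size that vanishes only at 0, so the
  atoms are the unique minimal generating set.\<close>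

lemma graver_basis_eq_monoid_atoms:
  "graver_basis k \<alpha> =
     monoid_atoms {(z, w). z \<in> nvec k \<and> w \<in> nvec k \<and> fact_hom k \<alpha> z = fact_hom k \<alpha> w}"
    (is "_ = monoid_atoms ?M")
proof -
  have "add_submonoid ?M"
    by (auto simp: add_submonoid_def zero_prod_def fact_hom_add)
  moreover have "x = 0" if "x \<in> ?M" "vlen k (fst x) + vlen k (snd x) = 0" for x
    using that vlen_eq_zero by (auto simp: zero_prod_def)
  ultimately have "minimal_generating_set B ?M \<longleftrightarrow> B = monoid_atoms ?M" for B
    by (intro minimal_generating_set_iff_monoid_atoms[where size = "\<lambda>x. vlen k (fst x) + vlen k (snd x)"])
      (auto simp: vlen_add)
  then show ?thesis unfolding graver_basis_def by simp
qed

section \<open>Chains of bounded weight as reachability\<close>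

text \<open>The reflexive transitive closure of this relation expresses that a chain of weight at
  most \<open>W\<close> joins two vertices, so chains can be composed and refined without handling
  lists.\<close>

definition light_adjacent :: "('v \<Rightarrow> 'v \<Rightarrow> nat) \<Rightarrow> 'v ugraph \<Rightarrow> nat \<Rightarrow> 'v \<Rightarrow> 'v \<Rightarrow> bool" where
  "light_adjacent l G W x y \<longleftrightarrow> x \<in> verts G \<and> y \<in> verts G \<and> {x, y} \<in> edges G \<and> l x y \<le> W"

text \<open>The set of labels is finite, and the inserted 0 is below every natural bound, so
  bounding the maximum amounts to bounding each label.\<close>

lemma chain_weight_le_iff: "chain_weight l p \<le> W \<longleftrightarrow> successively (\<lambda>x y. l x y \<le> W) p"
proof -
  have "finite {l (p ! i) (p ! Suc i) | i. Suc i < length p}"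
    by (rule finite_subset[of _ "(\<lambda>i. l (p ! i) (p ! Suc i)) ` {..<length p}"]) auto
  then show ?thesis
    unfolding chain_weight_def successively_conv_nth by (subst Max_le_iff) auto
qed

text \<open>A distinct chain is extended one step at a time; whenever the new vertex has been
  visited before, the chain is cut back to that visit.\<close>

lemma rtranclp_imp_distinct_chain:
  assumes "R\<^sup>*\<^sup>* u v" "u \<in> V" "\<And>x y. R x y \<Longrightarrow> y \<in> V"
  shows "\<exists>p. p \<noteq> [] \<and> hd p = u \<and> last p = v \<and> distinct p \<and> set p \<subseteq> V \<and> successively R p"
  using assms(1)
proof (induction rule: rtranclp_induct)
  case base
  show ?case by (rule exI[of _ "[u]"]) (use assms in auto)
next
  case (step y z)
  then obtain p where p: "p \<noteq> []" "hd p = u" "last p = y" "distinct p" "set p \<subseteq> V" "successively R p"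
    by blast
  show ?case
  proof (cases "z \<in> set p")
    case True
    then obtain p1 p2 where eq: "p = (p1 @ [z]) @ p2" using split_list by fastforce
    show ?thesis
      by (rule exI[of _ "p1 @ [z]"]) (use p eq in \<open>auto simp: successively_append_iff hd_append\<close>)
  next
    case False
    show ?thesis
      by (rule exI[of _ "p @ [z]"])
        (use p False step assms in \<open>auto simp: successively_append_iff\<close>)
  qed
qed

lemma light_adjacent_imp_path:
  assumes "(light_adjacent l G W)\<^sup>*\<^sup>* u v" "u \<in> verts G"
  shows "\<exists>p. is_path G u p v \<and> chain_weight l p \<le> W"
proof -
  obtain p where "p \<noteq> []" "hd p = u" "last p = v" "distinct p" "set p \<subseteq> verts G"
    and s: "successively (light_adjacent l G W) p"
    using rtranclp_imp_distinct_chain[OF assms] unfolding light_adjacent_def by blast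
  moreover have "successively (\<lambda>x y. {x, y} \<in> edges G) p" "successively (\<lambda>x y. l x y \<le> W) p"
    by (rule successively_mono[OF s], simp add: light_adjacent_def)+
  ultimately show ?thesis by (auto simp: is_path_def is_chain_def chain_weight_le_iff)
qed

lemma chain_imp_light_adjacent:
  assumes "is_chain G u p v" "chain_weight l p \<le> W"
  shows "(light_adjacent l G W)\<^sup>*\<^sup>* u v"
proof -
  have "successively (\<lambda>x y. {x, y} \<in> edges G) p \<Longrightarrow> successively (\<lambda>x y. l x y \<le> W) p \<Longrightarrow>
      set p \<subseteq> verts G \<Longrightarrow> p \<noteq> [] \<Longrightarrow> (light_adjacent l G W)\<^sup>*\<^sup>* (hd p) (last p)"
  proof (induction p rule: induct_list012)
    case (3 x y zs)
    then have "light_adjacent l G W x y" by (auto simp: light_adjacent_def)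
    moreover have "(light_adjacent l G W)\<^sup>*\<^sup>* (hd (y # zs)) (last (y # zs))"
      using 3 by (intro "3.IH") auto
    ultimately show ?case by (simp add: converse_rtranclp_into_rtranclp)
  qed auto
  then show ?thesis using assms by (auto simp: is_chain_def chain_weight_le_iff)
qed

lemma connected_imp_path:
  assumes "connected_graph G" "u \<in> verts G" "v \<in> verts G"
  shows "\<exists>p. is_path G u p v"
proof -
  obtain p where "is_chain G u p v" using assms by (auto simp: connected_graph_def)
  \<comment> \<open>With all labels 0 every edge is light, so the passage from chains to distinct
    chains applies to plain connectivity.\<close>
  then have "(light_adjacent (\<lambda>_ _. 0) G (chain_weight (\<lambda>_ _. 0) p))\<^sup>*\<^sup>* u v"
    by (rule chain_imp_light_adjacent) simp
  from light_adjacent_imp_path[OF this assms(2)] show ?thesis by blast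
qed

text \<open>Each edge of \<open>K\<close> can be replaced by a chain of \<open>G\<close> that is no
  heavier than the edge. A competing chain in \<open>K\<close> thus yields a path in
  \<open>G\<close> of at most its weight, and minimality of \<open>S\<close> in \<open>G\<close>
  applies to that path.\<close>

lemma min_weight_spanning_tree_supergraph:
  assumes S: "min_weight_spanning_tree l G S"
    and "verts G = verts K" "edges G \<subseteq> edges K"
    and light: "\<And>x y. {x, y} \<in> edges K \<Longrightarrow> x \<in> verts K \<Longrightarrow> y \<in> verts K \<Longrightarrow>
                  (light_adjacent l G (l x y))\<^sup>*\<^sup>* x y"
  shows "min_weight_spanning_tree l K S"
proof -
  have "chain_weight l p \<le> chain_weight l c"
    if u: "u \<in> verts K" and "v \<in> verts K" "is_path S u p v" "is_chain K u c v" for u v p c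
  proof -
    let ?W = "chain_weight l c"
    have "light_adjacent l K ?W \<le> (light_adjacent l G ?W)\<^sup>*\<^sup>*"
    proof (intro predicate2I)
      fix x y assume xy: "light_adjacent l K ?W x y"
      then have "(light_adjacent l G (l x y))\<^sup>*\<^sup>* x y"
        using light by (simp add: light_adjacent_def)
      then show "(light_adjacent l G ?W)\<^sup>*\<^sup>* x y"
        by (rule rtranclp_mono[THEN predicate2D, rotated])
          (use xy in \<open>auto simp: light_adjacent_def\<close>)
    qed
    then have "(light_adjacent l K ?W)\<^sup>*\<^sup>* \<le> (light_adjacent l G ?W)\<^sup>*\<^sup>*"
      by (metis rtranclp_idemp rtranclp_mono)
    then have "(light_adjacent l G ?W)\<^sup>*\<^sup>* u v"
      using chain_imp_light_adjacent[OF that(4) order_refl] by blast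
    then obtain c' where "is_path G u c' v" "chain_weight l c' \<le> ?W"
      using light_adjacent_imp_path u assms(2) by metis
    moreover from this have "chain_weight l p \<le> chain_weight l c'"
      using S u that assms(2) unfolding min_weight_spanning_tree_def is_path_def[of G] by metis
    ultimately show ?thesis by simp
  qed
  then show ?thesis
    using assms unfolding min_weight_spanning_tree_def spanning_tree_def by auto
qed

section \<open>Cover morphisms as label-preserving translations\<close>

text \<open>Adding the i-th unit vector adds \<alpha>_i to the image. The hypothesis
  \<open>\<alpha> i \<le> \<gamma>\<close> makes the truncated difference a true one, which gives
  both directions.\<close>

lemma cover_morphism_factorizations:
  assumes "i < k" "\<alpha> i \<le> \<gamma>"
  shows "cover_morphism i z \<in> factorizations k \<alpha> \<gamma> \<longleftrightarrow> z \<in> factorizations k \<alpha> (\<gamma> - \<alpha> i)"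
proof -
  have "fact_hom k \<alpha> z + \<alpha> i = \<gamma> \<longleftrightarrow> fact_hom k \<alpha> z = \<gamma> - \<alpha> i"
    using assms(2) by (fastforce simp: le_fun_def fun_eq_iff)
  then show ?thesis
    using assms unit_vec_nvec
    by (auto simp: cover_morphism_def factorizations_def fact_hom_add fact_hom_unit_vec)
qed

lemma vdist_cover_morphism: "vdist k (cover_morphism i z) (cover_morphism i w) = vdist k z w"
  by (simp add: cover_morphism_def add.commute[of _ "unit_vec i"] vdist_add)

section \<open>Light chains through the trees and the Graver edges\<close>

theorem theorem4p10:
  fixes d k :: nat
    and \<Gamma> :: "(nat \<Rightarrow> nat) set"
    and \<alpha> :: "nat \<Rightarrow> nat \<Rightarrow> nat"
    and \<gamma> :: "nat \<Rightarrow> nat"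
    and T :: "nat \<Rightarrow> (nat \<Rightarrow> nat) ugraph"
    and G' :: "(nat \<Rightarrow> nat) ugraph"
  assumes "affine_semigroup d \<Gamma>"
    and "inj_on \<alpha> {..<k}"
    and "minimal_generating_set (\<alpha> ` {..<k}) \<Gamma>"
    and "\<gamma> \<in> \<Gamma>"
    and "\<And>i. i < k \<Longrightarrow> diff_in \<gamma> (\<alpha> i) \<Gamma> \<Longrightarrow>
           \<exists>S. min_weight_spanning_tree (vdist k) (catenary_graph k \<alpha> (\<gamma> - \<alpha> i)) S \<and>
               T i = graph_image (cover_morphism i) S"
    and "\<And>i. i < k \<Longrightarrow> \<not> diff_in \<gamma> (\<alpha> i) \<Gamma> \<Longrightarrow> edges (T i) = {}"
    and "G' = \<lparr>verts = factorizations k \<alpha> \<gamma>,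
               edges = (\<Union>i<k. edges (T i)) \<union> graver_edges k \<alpha> \<gamma>\<rparr>"
  shows "connected_graph G' \<and>
         (\<forall>S. min_weight_spanning_tree (vdist k) G' S \<longrightarrow>
              min_weight_spanning_tree (vdist k) (catenary_graph k \<alpha> \<gamma>) S)"

proof -
  let ?K = "catenary_graph k \<alpha> \<gamma>" and ?Z = "factorizations k \<alpha> \<gamma>"
  have \<Gamma>_eq: "\<Gamma> = fact_hom k \<alpha> ` nvec k"
    using assms(3) hull_generators_eq_fact_hom_image unfolding minimal_generating_set_def by metis
  have nz: "\<alpha> i \<noteq> 0" if "i < k" for i
    using zero_notin_minimal_generating_set[OF assms(3)] that by (metis imageI lessThan_iff)
  have verts: "verts G' = ?Z" "verts ?K = ?Z" by (simp_all add: assms(7) catenary_graph_def)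

  have "edges (T i) \<subseteq> edges ?K" if i: "i < k" for i
  proof (cases "diff_in \<gamma> (\<alpha> i) \<Gamma>")
    case True
    then obtain S where S: "min_weight_spanning_tree (vdist k) (catenary_graph k \<alpha> (\<gamma> - \<alpha> i)) S"
      and T: "T i = graph_image (cover_morphism i) S"
      using assms(5) i by blast
    have "edges S \<subseteq> edges (catenary_graph k \<alpha> (\<gamma> - \<alpha> i))"
      using S by (simp add: min_weight_spanning_tree_def spanning_tree_def)
    moreover have "cover_morphism i ` e \<in> edges ?K"
      if "e \<in> edges (catenary_graph k \<alpha> (\<gamma> - \<alpha> i))" for e
    proof -
      from that obtain z w where zw: "e = {z, w}" "z \<in> factorizations k \<alpha> (\<gamma> - \<alpha> i)"
        "w \<in> factorizations k \<alpha> (\<gamma> - \<alpha> i)" "z \<noteq> w"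
        by (auto simp: catenary_graph_def)
      then have "cover_morphism i z \<in> ?Z" "cover_morphism i w \<in> ?Z"
        using cover_morphism_factorizations i True by (simp_all add: diff_in_def)
      \<comment> \<open>Injectivity of the translation keeps the image of an edge a two-element set,
        as an edge of \<open>?K\<close> must be.\<close>
      moreover have "cover_morphism i z \<noteq> cover_morphism i w"
        using zw(4) by (simp add: cover_morphism_def)
      ultimately show ?thesis using zw(1) by (auto simp: catenary_graph_def)
    qed
    ultimately show ?thesis by (auto simp: T graph_image_def)
  qed (use assms(6) i in auto)
  moreover have "graver_edges k \<alpha> \<gamma> \<subseteq> edges ?K"
    by (auto simp: graver_edges_def catenary_graph_def)
  ultimately have edges_sub: "edges G' \<subseteq> edges ?K" by (auto simp: assms(7))

  have common: "(light_adjacent (vdist k) G' W)\<^sup>*\<^sup>* z w"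
    if "z \<in> ?Z" "w \<in> ?Z" "z i > 0" "w i > 0" "vdist k z w \<le> W" for z w i W
  proof -
    have i: "i < k" using that(1,3) by (auto simp: factorizations_def nvec_def intro: ccontr)
    \<comment> \<open>Both i-th coordinates are positive, so the truncated subtraction is undone by
      the cover morphism.\<close>
    define z' w' where "z' = z - unit_vec i" and "w' = w - unit_vec i"
    have eq: "z = cover_morphism i z'" "w = cover_morphism i w'"
      using that(3,4) by (auto simp: z'_def w'_def cover_morphism_def unit_vec_def fun_eq_iff)
    have \<gamma>: "\<gamma> = fact_hom k \<alpha> z' + \<alpha> i" and z': "z' \<in> nvec k"
      using that(1) i unfolding eq
      by (auto simp: factorizations_def cover_morphism_def fact_hom_add fact_hom_unit_vec)
    then have le: "\<alpha> i \<le> \<gamma>" and "\<gamma> - \<alpha> i = fact_hom k \<alpha> z'"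
      by (auto simp: le_fun_def fun_eq_iff)
    then have diff: "diff_in \<gamma> (\<alpha> i) \<Gamma>" using z' by (auto simp: diff_in_def \<Gamma>_eq)
    let ?K' = "catenary_graph k \<alpha> (\<gamma> - \<alpha> i)"
    obtain S where S: "min_weight_spanning_tree (vdist k) ?K' S"
      and T: "T i = graph_image (cover_morphism i) S"
      using assms(5) i diff by blast
    have vS: "verts S = factorizations k \<alpha> (\<gamma> - \<alpha> i)" "verts ?K' = factorizations k \<alpha> (\<gamma> - \<alpha> i)"
      using S by (auto simp: min_weight_spanning_tree_def spanning_tree_def catenary_graph_def)
    have in': "z' \<in> factorizations k \<alpha> (\<gamma> - \<alpha> i)" "w' \<in> factorizations k \<alpha> (\<gamma> - \<alpha> i)"
      using that(1,2) cover_morphism_factorizations[of i k \<alpha>, OF i le] unfolding eq by auto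
    show ?thesis
    proof (cases "z' = w'")
      case True
      then show ?thesis by (simp add: eq)
    next
      case False
      obtain p where p: "is_path S z' p w'"
        using S connected_imp_path in' vS unfolding min_weight_spanning_tree_def spanning_tree_def
        by metis
      \<comment> \<open>The single edge is a competitor for the tree path \<open>p\<close>, so
        minimality bounds the weight of \<open>p\<close> by the label of that edge. A loop is no
        edge, hence the separate case \<open>z' = w'\<close>.\<close>
      have "is_chain ?K' z' [z', w'] w'"
        using in' False by (auto simp: is_chain_def catenary_graph_def)
      then have "chain_weight (vdist k) p \<le> chain_weight (vdist k) [z', w']"
        using S p in' vS unfolding min_weight_spanning_tree_def by metis
      also have "\<dots> \<le> W" using that(5) by (simp add: chain_weight_le_iff eq vdist_cover_morphism)
      finally have "(light_adjacent (vdist k) S W)\<^sup>*\<^sup>* z' w'"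
        using p chain_imp_light_adjacent unfolding is_path_def by metis
      \<comment> \<open>The walk in \<open>S\<close> is carried over step by step; translation by
        the unit vector keeps each label and lands in an edge of \<open>T i\<close>.\<close>
      then show ?thesis unfolding eq
      proof (induction rule: rtranclp_induct)
        case (step x y)
        have "cover_morphism i ` {x, y} \<in> edges (T i)"
          using step(2) unfolding T graph_image_def light_adjacent_def by (simp del: image_insert)
        then have "{cover_morphism i x, cover_morphism i y} \<in> edges G'"
          using i by (auto simp: assms(7))
        then have "light_adjacent (vdist k) G' W (cover_morphism i x) (cover_morphism i y)"
          using step(2) cover_morphism_factorizations[of i k \<alpha>, OF i le]
          by (simp add: light_adjacent_def verts vS vdist_cover_morphism)
        then show ?case using step(3) by (rule rtranclp.rtrancl_into_rtrancl[rotated])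
      qed auto
    qed
  qed

  have light: "(light_adjacent (vdist k) G' (vdist k z w))\<^sup>*\<^sup>* z w"
    if zw: "z \<in> ?Z" "w \<in> ?Z" for z w
  proof -
    let ?M = "{(z, w). z \<in> nvec k \<and> w \<in> nvec k \<and> fact_hom k \<alpha> z = fact_hom k \<alpha> w}"
    have M: "(z, w) \<in> ?M" using zw by (auto simp: factorizations_def)
    \<comment> \<open>Vectors without a common generator have gcd 0, which makes the four cases
      below exhaustive.\<close>
    have "vgcd z w = 0" if "\<And>i. \<not> (z i > 0 \<and> w i > 0)"
      using that by (fastforce simp: vgcd_def min_def)
    then consider (eq) "z = w" | (common) i where "z i > 0" "w i > 0"
      | (graver) "z \<noteq> w" "(z, w) \<in> graver_basis k \<alpha>"
      | (split) "z \<noteq> w" "vgcd z w = 0" "(z, w) \<notin> monoid_atoms ?M"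
      unfolding graver_basis_eq_monoid_atoms by blast
    then show ?thesis
    proof cases
      case graver
      then have "{z, w} \<in> edges G'" using zw by (auto simp: assms(7) graver_edges_def)
      then show ?thesis using zw by (auto simp: light_adjacent_def verts)
    next
      case split
      have "(z, w) \<noteq> 0" using split(1) by (auto simp: zero_prod_def)
      with split(3) M obtain p q where pq: "p \<in> ?M" "q \<in> ?M" "(z, w) = p + q" "p \<noteq> 0" "q \<noteq> 0"
        unfolding monoid_atoms_def by blast
      obtain z1 w1 z2 w2 where p: "p = (z1, w1)" and q: "q = (z2, w2)" by fastforce
      have z: "z = z1 + z2" and w: "w = w1 + w2" using pq(3) p q by auto
      have nvec: "z1 \<in> nvec k" "w1 \<in> nvec k" "z2 \<in> nvec k" "w2 \<in> nvec k"
        and hom: "fact_hom k \<alpha> z1 = fact_hom k \<alpha> w1" "fact_hom k \<alpha> z2 = fact_hom k \<alpha> w2"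
        using pq(1,2) p q by auto
      \<comment> \<open>If \<open>z2\<close> were 0, the image of \<open>w2\<close> would be 0,
        hence \<open>w2 = 0\<close> and \<open>q = 0\<close>; likewise \<open>w1 = 0\<close> would
        give \<open>p = 0\<close>.\<close>
      have "z2 \<noteq> 0" "w1 \<noteq> 0"
        using pq(4,5) p q nvec hom fact_hom_eq_zero[of k \<alpha>, OF nz]
        by (metis fact_hom_zero zero_prod_def)+
      \<comment> \<open>The intermediate factorization \<open>w1 + z2\<close> shares generator
        \<open>i\<close> with \<open>z\<close> through \<open>z2\<close>, and generator
        \<open>j\<close> with \<open>w\<close> through \<open>w1\<close>.\<close>
      then obtain i j where ij: "z2 i > 0" "w1 j > 0" by (auto simp: fun_eq_iff)
      have u: "w1 + z2 \<in> ?Z"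
        using zw(1) nvec hom by (auto simp: z factorizations_def fact_hom_add)
      have W: "vdist k z w = max (vlen k z1 + vlen k z2) (vlen k w1 + vlen k w2)"
        using split(2) by (simp add: vdist_disjoint z w vlen_add)
      \<comment> \<open>Cancelling the common summand \<open>z2\<close> leaves the distance of
        \<open>z1\<close> and \<open>w1\<close>, which is at most the larger of their lengths; the
        second step cancels \<open>w1\<close> in the same way.\<close>
      have "vdist k z (w1 + z2) = vdist k z1 w1"
        using vdist_add[of k z2 z1 w1] by (simp add: z add.commute)
      also have "\<dots> \<le> vdist k z w" using vdist_le[of k z1 w1] W by simp
      finally have "(light_adjacent (vdist k) G' (vdist k z w))\<^sup>*\<^sup>* z (w1 + z2)"
        using common[OF zw(1) u, of i] ij by (simp add: z)
      moreover have "vdist k (w1 + z2) w \<le> vdist k z w"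
        using vdist_add[of k w1 z2 w2] vdist_le[of k z2 w2] W by (simp add: w)
      then have "(light_adjacent (vdist k) G' (vdist k z w))\<^sup>*\<^sup>* (w1 + z2) w"
        using common[OF u zw(2), of j] ij by (simp add: w)
      ultimately show ?thesis by simp
    qed (use zw common in auto)
  qed

  \<comment> \<open>Connectedness includes having a vertex, which
    \<open>\<gamma> \<in> \<Gamma>\<close> provides; the light chains then join any two
    vertices.\<close>
  have "?Z \<noteq> {}" using assms(4) by (auto simp: \<Gamma>_eq factorizations_def)
  then have "connected_graph G'"
    using light light_adjacent_imp_path verts(1)
    unfolding connected_graph_def is_path_def by metis
  moreover have "min_weight_spanning_tree (vdist k) ?K S"
    if "min_weight_spanning_tree (vdist k) G' S" for S
    using that
    by (rule min_weight_spanning_tree_supergraph) (use edges_sub light verts in auto)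
  ultimately show ?thesis by blast
qed

end
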